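(* Let $n\ge 2$, let $e_1,e_2$ be top-dimensional cells of $P_n$, and let $\phi_{w_1}\in e_1$ and $\phi_{w_2}\in e_2$. Then $\phi_{w_1}$ is geometrically isotopic to $\phi_{w_2}$ if and only if there is a (finite, possibly empty) sequence of elementary geometric isotopies connecting $\phi_{v(e_1)}$ to $\phi_{v(e_2)}$, the representative knots of $e_1$ and $e_2$.
   Context: Plumbers' curves. Let $v=(v_1,\dots,v_{n-1})\in((0,1)^3)^{n-1}$. Write $v_i=(v_i^x,v_i^y,v_i^z)$, and by convention $v_0=(0,0,0)$, $v_n=(1,1,1)$. For $0\le i\le n-1$ define three (possibly degenerate) straight segments, called pipes: $\mathbf x_i$ from $(v_i^x,v_i^y,v_i^z)$ to $(v_{i+1}^x,v_i^y,v_i^z)$; $\mathbf y_i$ from $(v_{i+1}^x,v_i^y,v_i^z)$ to $(v_{i+1}^x,v_{i+1}^y,v_i^z)$; $\mathbf z_i$ from $(v_{i+1}^x,v_{i+1}^y,v_i^z)$ to $(v_{i+1}^x,v_{i+1}^y,v_{i+1}^z)$. The $n$-move plumbers' curve $\phi_v$ is the piecewise linear path traversing the pipes linearly in the order $\mathbf x_0,\mathbf y_0,\mathbf z_0,\mathbf x_1,\dots,\mathbf z_{n-1}$. The space $P_n$ of all $\phi_v$ is identified (and topologized) with $((0,1)^3)^{n-1}$ via $v$. Two pipes are distant if, in this ordered sequence, they are separated by at least three intervening pipes. The curve $\phi_v$ is singular if the images of some pair of its distant pipes intersect; otherwise it is a plumbers' knot. $K_n\subseteq P_n$ is the subspace of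 plumbers' knots. Two plumbers' knots in $K_n$ are geometrically isotopic if they are joined by a continuous path in $K_n$. Cells. For $\sigma_x,\sigma_y,\sigma_z\in\Sigma_{n-1}$ (symmetric group), $e(\sigma_x,\sigma_y,\sigma_z)\subset P_n$ is the set of $\phi_v$ with $0<v^c_{\sigma_c(1)}<\cdots<v^c_{\sigma_c(n-1)}<1$ for each $c\in\{x,y,z\}$; these are the top-dimensional cells, and all their elements are plumbers' knots. The representative knot of $e=e(\sigma_x,\sigma_y,\sigma_z)$ is $\phi_{v(e)}$ with $v(e)_i=\left(\frac{\sigma_x^{-1}(i)}n,\frac{\sigma_y^{-1}(i)}n,\frac{\sigma_z^{-1}(i)}n\right)$ for $1\le i\le n-1$. A transposition $\tau$ appears in $\sigma\in\Sigma_{n-1}$ if $\tau=(\sigma(i)\ \sigma(i+1))$ for some $i\in\{1,\dots,n-2\}$. Elementary geometric isotopies. Let $c\in\{x,y,z\}$, let $\tau$ be a transposition appearing in $\sigma_c$, and let $\tau_c\cdot e$ be the cell obtained from $e=e(\sigma_x,\sigma_y,\sigma_z)$ by replacing $\sigma_c$ with $\tau\sigma_c$ (composition, $(\tau\sigma_c)(i)=\tau(\sigma_c(i))$). If the straight-line path $t\mapsto\phi_{(1-t)v(e)+t\,v(\tau_c\cdot e)}$, $t\in[0,1]$, lies entirely in $K_n$, it is called an elementary geometric isotopy from $\phi_{v(e)}$ to $\phi_{v(\tau_c\cdot e)}$. *)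

theory Defs
  imports "HOL-Analysis.Analysis" "HOL-Combinatorics.Permutations"
begin

text \<open>
  Following the standard identification, the plumbers' curve with interior vertices
  \<open>v 1, \<dots>, v (n - 1)\<close> is represented by \<open>v\<close> itself, as an extensional function on
  \<open>{1..<n}\<close>. The product topology on \<open>nat \<Rightarrow> real ^ 3\<close> then induces on the space of curves
  the topology of \<open>((0,1)\<^sup>3)\<^sup>n\<^sup>-\<^sup>1\<close>. The indices \<open>1, 2, 3\<close> of type \<open>3\<close> stand for
  the \<open>x\<close>, \<open>y\<close> and \<open>z\<close> directions.
\<close>

definition plumbers_curves :: "nat \<Rightarrow> (nat \<Rightarrow> real ^ 3) set" where
  "plumbers_curves n = (\<Pi>\<^sub>E i\<in>{1..<n}. {p. \<forall>c. 0 < p $ c \<and> p $ c < 1})"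

definition vertex :: "nat \<Rightarrow> (nat \<Rightarrow> real ^ 3) \<Rightarrow> nat \<Rightarrow> real ^ 3" where
  "vertex n v i = (if i = 0 then vec 0 else if i = n then vec 1 else v i)"

definition x_pipe :: "nat \<Rightarrow> (nat \<Rightarrow> real ^ 3) \<Rightarrow> nat \<Rightarrow> real \<Rightarrow> real ^ 3" where
  "x_pipe n v i = (let p = vertex n v i; q = vertex n v (i + 1) in
     linepath (vector [p $ 1, p $ 2, p $ 3]) (vector [q $ 1, p $ 2, p $ 3]))"

definition y_pipe :: "nat \<Rightarrow> (nat \<Rightarrow> real ^ 3) \<Rightarrow> nat \<Rightarrow> real \<Rightarrow> real ^ 3" where
  "y_pipe n v i = (let p = vertex n v i; q = vertex n v (i + 1) in
     linepath (vector [q $ 1, p $ 2, p $ 3]) (vector [q $ 1, q $ 2, p $ 3]))"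

definition z_pipe :: "nat \<Rightarrow> (nat \<Rightarrow> real ^ 3) \<Rightarrow> nat \<Rightarrow> real \<Rightarrow> real ^ 3" where
  "z_pipe n v i = (let p = vertex n v i; q = vertex n v (i + 1) in
     linepath (vector [q $ 1, q $ 2, p $ 3]) (vector [q $ 1, q $ 2, q $ 3]))"

text \<open>The curve runs through \<open>pipe n v 0, \<dots>, pipe n v (3 * n - 1)\<close> in this order.\<close>

definition pipe :: "nat \<Rightarrow> (nat \<Rightarrow> real ^ 3) \<Rightarrow> nat \<Rightarrow> real \<Rightarrow> real ^ 3" where
  "pipe n v k =
     (if k mod 3 = 0 then x_pipe n v (k div 3)
      else if k mod 3 = 1 then y_pipe n v (k div 3)
      else z_pipe n v (k div 3))"

definition distant :: "nat \<Rightarrow> nat \<Rightarrow> bool" where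
  "distant j k \<longleftrightarrow> card {min j k<..<max j k} \<ge> 3"

definition singular :: "nat \<Rightarrow> (nat \<Rightarrow> real ^ 3) \<Rightarrow> bool" where
  "singular n v \<longleftrightarrow>
     (\<exists>j<3 * n. \<exists>k<3 * n. distant j k \<and>
        path_image (pipe n v j) \<inter> path_image (pipe n v k) \<noteq> {})"

definition plumbers_knots :: "nat \<Rightarrow> (nat \<Rightarrow> real ^ 3) set" where
  "plumbers_knots n = {v \<in> plumbers_curves n. \<not> singular n v}"

definition geometrically_isotopic ::
    "nat \<Rightarrow> (nat \<Rightarrow> real ^ 3) \<Rightarrow> (nat \<Rightarrow> real ^ 3) \<Rightarrow> bool" where
  "geometrically_isotopic n v w \<longleftrightarrow> path_component (plumbers_knots n) v w"

text \<open>
  A top-dimensional cell is given by a triple of permutations \<open>\<sigma> 1, \<sigma> 2, \<sigma> 3\<close> of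
  \<open>{1..<n}\<close>, one per direction; distinct triples give disjoint nonempty cells.
\<close>

definition cell_index :: "nat \<Rightarrow> (3 \<Rightarrow> nat \<Rightarrow> nat) \<Rightarrow> bool" where
  "cell_index n \<sigma> \<longleftrightarrow> (\<forall>c. \<sigma> c permutes {1..<n})"

definition cell :: "nat \<Rightarrow> (3 \<Rightarrow> nat \<Rightarrow> nat) \<Rightarrow> (nat \<Rightarrow> real ^ 3) set" where
  "cell n \<sigma> =
     {v \<in> plumbers_curves n. \<forall>c. strict_mono_on {1..<n} (\<lambda>i. v (\<sigma> c i) $ c)}"

definition representative :: "nat \<Rightarrow> (3 \<Rightarrow> nat \<Rightarrow> nat) \<Rightarrow> nat \<Rightarrow> real ^ 3" where
  "representative n \<sigma> = (\<lambda>i\<in>{1..<n}. \<chi> c. real (inv (\<sigma> c) i) / real n)"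

definition appears_in :: "nat \<Rightarrow> (nat \<Rightarrow> nat) \<Rightarrow> (nat \<Rightarrow> nat) \<Rightarrow> bool" where
  "appears_in n \<tau> s \<longleftrightarrow> (\<exists>i\<in>{1..n - 2}. \<tau> = Transposition.transpose (s i) (s (i + 1)))"

definition straight_line ::
    "nat \<Rightarrow> (nat \<Rightarrow> real ^ 3) \<Rightarrow> (nat \<Rightarrow> real ^ 3) \<Rightarrow> real \<Rightarrow> nat \<Rightarrow> real ^ 3" where
  "straight_line n v w t = (\<lambda>i\<in>{1..<n}. (1 - t) *\<^sub>R v i + t *\<^sub>R w i)"

text \<open>
  The relation on knots that an elementary geometric isotopy leads from \<open>v\<close> to \<open>w\<close>;
  such an isotopy is determined by its end points.
\<close>

definition elementary_isotopy ::
    "nat \<Rightarrow> (nat \<Rightarrow> real ^ 3) \<Rightarrow> (nat \<Rightarrow> real ^ 3) \<Rightarrow> bool" where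
  "elementary_isotopy n v w \<longleftrightarrow>
     (\<exists>\<sigma> c \<tau>. cell_index n \<sigma> \<and> appears_in n \<tau> (\<sigma> c) \<and>
        v = representative n \<sigma> \<and> w = representative n (\<sigma>(c := \<tau> \<circ> \<sigma> c)) \<and>
        (\<forall>t\<in>{0..1}. straight_line n v w t \<in> plumbers_knots n))"

end

theory Submission
  imports Defs
begin

text \<open>
  A pipe is an axis-parallel box whose faces lie at coordinates of vertices, and two boxes
  intersect iff certain weak inequalities hold between those coordinates. Hence singularity
  depends only on the three weak orders that the coordinates of a curve \<open>v\<close> induce on its
  vertices, and it is preserved when strict inequalities are relaxed. Say that \<open>u\<close> refines \<open>v\<close>
  if every strict inequality between coordinates of \<open>v\<close> also holds for \<open>u\<close>. Then all
  refinements of a knot are knots (\<open>refines_knot\<close>), and they form a convex set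
  (\<open>straight_line_refines\<close>). These two facts replace an analysis of the walls between cells
  and any perturbation of paths into general position.

  Each curve in an open cell is a knot and is joined to the representative of the cell by a
  straight line; so a chain of elementary isotopies between representatives yields a geometric
  isotopy between arbitrary knots of the two cells.

  Conversely, representatives \<open>representative n \<sigma>\<close> and \<open>representative n \<sigma>'\<close> that refine the
  same knot \<open>v\<close> are joined by elementary isotopies (\<open>refining_representatives_connected\<close>).
  Indeed, bubble sort turns \<open>\<sigma> c\<close> into \<open>\<sigma>' c\<close> by exchanging neighbours on whose order the two
  disagree; \<open>v\<close> must have equal \<open>c\<close>-coordinates at such a pair, so all intermediate
  representatives refine \<open>v\<close>, and so do the straight lines between them. Thus each knot
  determines one class of representatives, namely those refining it. Along a path of knots this
  class is locally constant: nearby knots refine a given one by continuity, so a representative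
  refining a nearby knot also refines the given one. As \<open>[0,1]\<close> is connected, the classes
  at both ends of a geometric isotopy agree.
\<close>

section \<open>Pipes as boxes\<close>

text \<open>
  The curve changes its coordinates cyclically in the order \<open>1, 2, 3\<close>. So the \<open>c\<close>-coordinate of
  the starting point of pipe \<open>k\<close> is that of vertex \<open>stage c k\<close>, and the end point of pipe \<open>k\<close> is
  the starting point of pipe \<open>k + 1\<close>. This treats the three kinds of pipes uniformly.
\<close>

definition stage :: "3 \<Rightarrow> nat \<Rightarrow> nat" where
  "stage c k = (if c = 1 then (k + 2) div 3 else if c = 2 then (k + 1) div 3 else k div 3)"

definition corner :: "nat \<Rightarrow> (nat \<Rightarrow> real ^ 3) \<Rightarrow> nat \<Rightarrow> real ^ 3" where
  "corner n v k = (\<chi> c. vertex n v (stage c k) $ c)"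

lemma pipe_eq_linepath: "pipe n v k = linepath (corner n v k) (corner n v (Suc k))"
proof -
  obtain i r where k: "k = 3 * i + r" "r < 3"
    by (metis div_mult_mod_eq mult.commute mod_less_divisor zero_less_numeral)
  then consider "r = 0" | "r = 1" | "r = 2" by linarith
  then show ?thesis
  proof cases
    case 1
    have "(3 * i + 2) div 3 = i" "(3 * i + 1) div 3 = i" "(3 * i + 3) div 3 = Suc i" by presburger+
    with 1 show ?thesis unfolding k
      by (auto simp: pipe_def x_pipe_def Let_def corner_def stage_def vec_eq_iff forall_3
          intro!: arg_cong2[where f = linepath])
  next
    case 2
    have "(3 * i + 1) mod 3 = 1" "(3 * i + 1) div 3 = i" "(3 * i + 2) div 3 = i"
      "(3 * i + 3) div 3 = Suc i" "(3 * i + 4) div 3 = Suc i"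
      by presburger+
    with 2 show ?thesis unfolding k
      by (auto simp: pipe_def y_pipe_def Let_def corner_def stage_def vec_eq_iff forall_3
          intro!: arg_cong2[where f = linepath])
  next
    case 3
    have "(3 * i + 2) mod 3 = 2" "(3 * i + 2) div 3 = i"
      "(3 * i + 3) div 3 = Suc i" "(3 * i + 4) div 3 = Suc i" "(3 * i + 5) div 3 = Suc i"
      by presburger+
    with 3 show ?thesis unfolding k
      by (auto simp: pipe_def z_pipe_def Let_def corner_def stage_def vec_eq_iff forall_3
          intro!: arg_cong2[where f = linepath])
  qed
qed

lemma only_one_stage_changes: "\<exists>d. \<forall>c. c \<noteq> d \<longrightarrow> stage c (Suc k) = stage c k"
proof -
  consider "k mod 3 = 0" | "k mod 3 = 1" | "k mod 3 = 2" by linarith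
  then show ?thesis
  proof cases
    case 1
    then have "(k + 2) div 3 = k div 3" "(k + 1) div 3 = k div 3" by presburger+
    then show ?thesis by (intro exI[of _ 1]) (simp add: forall_3 stage_def)
  next
    case 2
    then have "(k + 3) div 3 = (k + 2) div 3" "(k + 1) div 3 = k div 3" by presburger+
    then show ?thesis by (intro exI[of _ 2]) (simp add: forall_3 stage_def)
  next
    case 3
    then have "(k + 3) div 3 = (k + 2) div 3" "(k + 2) div 3 = (k + 1) div 3" by presburger+
    then show ?thesis by (intro exI[of _ 3]) (simp add: forall_3 stage_def)
  qed
qed

text \<open>
  Only the coordinate \<open>d\<close> varies along the segment, so it alone determines the parameter of a
  point, and the conditions on the other coordinates do not interact.
\<close>

lemma axis_parallel_segment_eq_box:
  fixes p q :: "real ^ 'm"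
  assumes "\<And>c. c \<noteq> d \<Longrightarrow> p $ c = q $ c"
  shows "closed_segment p q = {r. \<forall>c. r $ c \<in> closed_segment (p $ c) (q $ c)}"
proof (intro set_eqI iffI)
  fix r assume "r \<in> closed_segment p q"
  then show "r \<in> {r. \<forall>c. r $ c \<in> closed_segment (p $ c) (q $ c)}"
    by (auto simp: in_segment)
next
  fix r assume "r \<in> {r. \<forall>c. r $ c \<in> closed_segment (p $ c) (q $ c)}"
  then have r: "r $ c \<in> closed_segment (p $ c) (q $ c)" for c by blast
  obtain u where u: "0 \<le> u" "u \<le> 1" "r $ d = (1 - u) * p $ d + u * q $ d"
    using r[of d] by (auto simp: in_segment)
  have "r $ c = (1 - u) * p $ c + u * q $ c" for c
  proof (cases "c = d")
    case False
    then have "r $ c = q $ c" "p $ c = q $ c" using r[of c] assms[of c] by auto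
    then show ?thesis by (simp add: algebra_simps)
  qed (use u in simp)
  then have "r = (1 - u) *\<^sub>R p + u *\<^sub>R q" by (simp add: vec_eq_iff)
  with u show "r \<in> closed_segment p q" by (auto simp: in_segment)
qed

lemma path_image_pipe:
  "path_image (pipe n v k) = {r. \<forall>c. r $ c \<in>
     closed_segment (vertex n v (stage c k) $ c) (vertex n v (stage c (Suc k)) $ c)}"
proof -
  obtain d where "\<And>c. c \<noteq> d \<Longrightarrow> stage c (Suc k) = stage c k"
    using only_one_stage_changes by blast
  then have "\<And>c. c \<noteq> d \<Longrightarrow> corner n v k $ c = corner n v (Suc k) $ c"
    by (simp add: corner_def)
  from axis_parallel_segment_eq_box[OF this] show ?thesis
    by (simp add: pipe_eq_linepath corner_def)
qed

text \<open>
  The right-hand side is a negation-free combination of weak inequalities between end points, which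
  is what makes intersection of pipes survive the relaxation of strict inequalities.
\<close>

lemma closed_segments_meet_iff:
  fixes a b c d :: real
  shows "closed_segment a b \<inter> closed_segment c d \<noteq> {} \<longleftrightarrow>
    (a \<le> c \<or> a \<le> d \<or> b \<le> c \<or> b \<le> d) \<and> (c \<le> a \<or> c \<le> b \<or> d \<le> a \<or> d \<le> b)"
  by (auto simp: closed_segment_eq_real_ivl)

lemma pipes_meet_iff:
  "path_image (pipe n v j) \<inter> path_image (pipe n v k) \<noteq> {} \<longleftrightarrow>
    (\<forall>c. closed_segment (vertex n v (stage c j) $ c) (vertex n v (stage c (Suc j)) $ c) \<inter>
         closed_segment (vertex n v (stage c k) $ c) (vertex n v (stage c (Suc k)) $ c) \<noteq> {})"
  (is "?L \<longleftrightarrow> (\<forall>c. ?A c \<inter> ?B c \<noteq> {})")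
proof
  assume ?L
  then show "\<forall>c. ?A c \<inter> ?B c \<noteq> {}" unfolding path_image_pipe by blast
next
  assume "\<forall>c. ?A c \<inter> ?B c \<noteq> {}"
  then have "\<forall>c. \<exists>x. x \<in> ?A c \<inter> ?B c" by blast
  then obtain r where "\<forall>c. r c \<in> ?A c \<inter> ?B c" by (rule choice[THEN exE])
  then have "(\<chi> c. r c) \<in> path_image (pipe n v j) \<inter> path_image (pipe n v k)"
    unfolding path_image_pipe by auto
  then show ?L by blast
qed

lemma stage_le:
  assumes "k \<le> 3 * n"
  shows "stage c k \<le> n"
  using assms by (auto simp: stage_def)

section \<open>Singularity and the order of coordinates\<close>

text \<open>
  The name follows the case in which \<open>u\<close> has pairwise different coordinates: the linear
  orders given by \<open>u\<close> then refine the weak orders given by \<open>v\<close>. Geometrically, \<open>v\<close> lies in the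
  closure of the stratum of \<open>u\<close>.
\<close>

definition refines :: "nat \<Rightarrow> (nat \<Rightarrow> real ^ 3) \<Rightarrow> (nat \<Rightarrow> real ^ 3) \<Rightarrow> bool" where
  "refines n u v \<longleftrightarrow>
     (\<forall>c. \<forall>i\<in>{1..<n}. \<forall>j\<in>{1..<n}. v i $ c < v j $ c \<longrightarrow> u i $ c < u j $ c)"

lemma refines_trans: "refines n u v \<Longrightarrow> refines n v w \<Longrightarrow> refines n u w"
  unfolding refines_def by blast

lemma vertex_coordinate_bounds:
  assumes "v \<in> plumbers_curves n" "i \<le> n"
  shows "0 \<le> vertex n v i $ c" "vertex n v i $ c \<le> 1"
    and "vertex n v i $ c = 0 \<longleftrightarrow> i = 0" "vertex n v i $ c = 1 \<longleftrightarrow> i = n \<and> n \<noteq> 0"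
proof -
  have "0 < v i $ c" "v i $ c < 1" if "i \<noteq> 0" "i \<noteq> n"
    using assms that by (auto simp: plumbers_curves_def PiE_iff)
  then show "0 \<le> vertex n v i $ c" "vertex n v i $ c \<le> 1"
    and "vertex n v i $ c = 0 \<longleftrightarrow> i = 0" "vertex n v i $ c = 1 \<longleftrightarrow> i = n \<and> n \<noteq> 0"
    by (cases "i = 0"; cases "i = n"; simp add: vertex_def; fail)+
qed

text \<open>
  The end vertices cause no exception: all interior coordinates lie strictly between those of
  vertex \<open>0\<close> and vertex \<open>n\<close>, for both curves.
\<close>

lemma refines_vertex_le:
  assumes "u \<in> plumbers_curves n" "v \<in> plumbers_curves n" "refines n u v"
    and "i \<le> n" "j \<le> n" "vertex n u i $ c \<le> vertex n u j $ c"
  shows "vertex n v i $ c \<le> vertex n v j $ c"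
proof -
  note u = vertex_coordinate_bounds[OF assms(1)] and v = vertex_coordinate_bounds[OF assms(2)]
  consider "i = 0" | "j = n" "n \<noteq> 0" | "i = n" "j \<noteq> n" "n \<noteq> 0" | "j = 0" "i \<noteq> 0"
    | "i \<in> {1..<n}" "j \<in> {1..<n}"
    using assms(4,5) by force
  then show ?thesis
  proof cases
    case 1
    then show ?thesis using v(1)[OF assms(5)] v(3)[OF assms(4)] by simp
  next
    case 2
    then show ?thesis using v(2)[OF assms(4)] v(4)[OF assms(5)] by simp
  next
    case 3
    then have "vertex n u i $ c = 1" "vertex n u j $ c \<noteq> 1"
      using u(4)[OF assms(4)] u(4)[OF assms(5)] by simp_all
    then show ?thesis using u(2)[OF assms(5), of c] assms(6) by linarith
  next
    case 4
    then have "vertex n u j $ c = 0" "vertex n u i $ c \<noteq> 0"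
      using u(3)[OF assms(4)] u(3)[OF assms(5)] by simp_all
    then show ?thesis using u(1)[OF assms(4), of c] assms(6) by linarith
  next
    case 5
    then have "\<not> u j $ c < u i $ c" using assms(6) by (simp add: vertex_def)
    then have "\<not> v j $ c < v i $ c" using assms(3) 5 unfolding refines_def by blast
    with 5 show ?thesis by (simp add: vertex_def)
  qed
qed

lemma refines_singular:
  assumes "u \<in> plumbers_curves n" "v \<in> plumbers_curves n" "refines n u v" "singular n u"
  shows "singular n v"
proof -
  obtain j k where jk: "j < 3 * n" "k < 3 * n" "distant j k"
    and meet: "path_image (pipe n u j) \<inter> path_image (pipe n u k) \<noteq> {}"
    using assms(4) unfolding singular_def by blast
  have le: "stage c j \<le> n" "stage c (Suc j) \<le> n" "stage c k \<le> n" "stage c (Suc k) \<le> n" for c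
    using jk by (auto intro!: stage_le)
  have "path_image (pipe n v j) \<inter> path_image (pipe n v k) \<noteq> {}"
    unfolding pipes_meet_iff closed_segments_meet_iff
  proof
    fix c
    note le = le[of c] and mono = refines_vertex_le[OF assms(1-3), where c = c]
    from meet show "(vertex n v (stage c j) $ c \<le> vertex n v (stage c k) $ c \<or>
        vertex n v (stage c j) $ c \<le> vertex n v (stage c (Suc k)) $ c \<or>
        vertex n v (stage c (Suc j)) $ c \<le> vertex n v (stage c k) $ c \<or>
        vertex n v (stage c (Suc j)) $ c \<le> vertex n v (stage c (Suc k)) $ c) \<and>
       (vertex n v (stage c k) $ c \<le> vertex n v (stage c j) $ c \<or>
        vertex n v (stage c k) $ c \<le> vertex n v (stage c (Suc j)) $ c \<or>
        vertex n v (stage c (Suc k)) $ c \<le> vertex n v (stage c j) $ c \<or>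
        vertex n v (stage c (Suc k)) $ c \<le> vertex n v (stage c (Suc j)) $ c)"
      unfolding pipes_meet_iff closed_segments_meet_iff
      using mono[OF le(1,3)] mono[OF le(1,4)] mono[OF le(2,3)] mono[OF le(2,4)]
        mono[OF le(3,1)] mono[OF le(3,2)] mono[OF le(4,1)] mono[OF le(4,2)]
      by blast
  qed
  with jk show ?thesis unfolding singular_def by blast
qed

lemma refines_knot:
  assumes "u \<in> plumbers_curves n" "v \<in> plumbers_knots n" "refines n u v"
  shows "u \<in> plumbers_knots n"
  using assms refines_singular unfolding plumbers_knots_def by blast

lemma distant_iff: "distant j k \<longleftrightarrow> j + 4 \<le> k \<or> k + 4 \<le> j"
  unfolding distant_def by (auto simp: min_def max_def)

text \<open>
  Each of the two pipes moves in one direction only, so a third direction \<open>c\<close> remains in which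
  both stay put. Since \<open>stage c\<close> grows by one every three pipes, it has different values at pipes
  that are at least four places apart.
\<close>

lemma distant_pipes_at_different_stages:
  assumes "distant j k"
  obtains c where "stage c (Suc j) = stage c j" "stage c (Suc k) = stage c k"
    "stage c j \<noteq> stage c k"
proof -
  obtain d e where d: "\<And>c. c \<noteq> d \<Longrightarrow> stage c (Suc j) = stage c j"
    and e: "\<And>c. c \<noteq> e \<Longrightarrow> stage c (Suc k) = stage c k"
    using only_one_stage_changes[of j] only_one_stage_changes[of k] by blast
  have "card {d, e} < CARD(3)" by (simp add: card_insert_if)
  then have "{d, e} \<noteq> (UNIV :: 3 set)" by force
  then obtain c where "c \<noteq> d" "c \<noteq> e" by blast
  moreover have "stage c j \<noteq> stage c k"
    using assms unfolding distant_iff stage_def by (auto split: if_splits)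
  ultimately show ?thesis using that d e by blast
qed

lemma injective_coordinates_knot:
  assumes "v \<in> plumbers_curves n" "\<And>c. inj_on (\<lambda>i. v i $ c) {1..<n}"
  shows "v \<in> plumbers_knots n"
proof -
  have inj: "i = j" if ij: "i \<le> n" "j \<le> n" and eq: "vertex n v i $ c = vertex n v j $ c" for i j c
  proof (cases "i \<in> {1..<n} \<and> j \<in> {1..<n}")
    case True
    then have "v i $ c = v j $ c" using eq by (simp add: vertex_def)
    with True show ?thesis using inj_onD[OF assms(2)[of c]] by blast
  next
    case False
    then have "i = 0 \<or> i = n \<or> j = 0 \<or> j = n" using ij by force
    moreover have "i = 0 \<longleftrightarrow> j = 0" "i = n \<and> n \<noteq> 0 \<longleftrightarrow> j = n \<and> n \<noteq> 0"
      using vertex_coordinate_bounds(3,4)[OF assms(1) ij(1), of c]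
        vertex_coordinate_bounds(3,4)[OF assms(1) ij(2), of c] unfolding eq by blast+
    ultimately show ?thesis by blast
  qed
  have "path_image (pipe n v j) \<inter> path_image (pipe n v k) = {}"
    if jk: "j < 3 * n" "k < 3 * n" "distant j k" for j k
  proof -
    obtain c where c: "stage c (Suc j) = stage c j" "stage c (Suc k) = stage c k"
      "stage c j \<noteq> stage c k"
      using distant_pipes_at_different_stages[OF jk(3)] .
    have "vertex n v (stage c j) $ c \<noteq> vertex n v (stage c k) $ c"
      using inj[of "stage c j" "stage c k" c] c jk stage_le[of j n c] stage_le[of k n c] by auto
    then have "closed_segment (vertex n v (stage c j) $ c) (vertex n v (stage c (Suc j)) $ c) \<inter>
         closed_segment (vertex n v (stage c k) $ c) (vertex n v (stage c (Suc k)) $ c) = {}"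
      using c by simp
    then show ?thesis using pipes_meet_iff by metis
  qed
  then have "\<not> singular n v" unfolding singular_def by blast
  with assms(1) show ?thesis by (simp add: plumbers_knots_def)
qed

section \<open>Straight lines\<close>

lemma straight_line_in_curves:
  assumes "v \<in> plumbers_curves n" "w \<in> plumbers_curves n" "t \<in> {0..1}"
  shows "straight_line n v w t \<in> plumbers_curves n"
proof -
  have "0 < (1 - t) * a + t * b \<and> (1 - t) * a + t * b < 1"
    if "0 < a" "a < 1" "0 < b" "b < 1" for a b :: real
    using convexD[OF convex_real_interval(8), of a 0 1 b "1 - t" t] that assms(3) by auto
  then show ?thesis
    using assms(1,2) by (auto simp: plumbers_curves_def straight_line_def PiE_iff)
qed

text \<open>
  A convex combination of two solutions of a strict linear inequality is again a solution.
\<close>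

lemma straight_line_refines:
  assumes "refines n u v" "refines n w v" "t \<in> {0..1}"
  shows "refines n (straight_line n u w t) v"
  unfolding refines_def
proof (intro allI ballI impI)
  fix c i j assume ij: "i \<in> {1..<n}" "j \<in> {1..<n}" "v i $ c < v j $ c"
  then have *: "u i $ c < u j $ c" "w i $ c < w j $ c"
    using assms unfolding refines_def by blast+
  have "(1 - t) * u i $ c + t * w i $ c < (1 - t) * u j $ c + t * w j $ c"
  proof (cases "t = 0")
    case False
    then have "t * w i $ c < t * w j $ c" using * assms(3) by auto
    moreover have "(1 - t) * u i $ c \<le> (1 - t) * u j $ c"
      using * assms(3) by (intro mult_left_mono) auto
    ultimately show ?thesis by linarith
  qed (use * in simp)
  with ij show "straight_line n u w t i $ c < straight_line n u w t j $ c"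
    by (simp add: straight_line_def)
qed

lemma straight_line_isotopy:
  assumes "u \<in> extensional {1..<n}" "w \<in> extensional {1..<n}"
    and "\<And>t. t \<in> {0..1} \<Longrightarrow> straight_line n u w t \<in> plumbers_knots n"
  shows "geometrically_isotopic n u w"
proof -
  have "continuous_on {0..1} (straight_line n u w)"
  proof (rule continuous_on_coordinatewise_then_product)
    fix i show "continuous_on {0..1} (\<lambda>t. straight_line n u w t i)"
      by (cases "i \<in> {1..<n}") (auto simp: straight_line_def intro!: continuous_intros)
  qed
  moreover have "straight_line n u w 0 = u" "straight_line n u w 1 = w"
    using assms(1,2) by (auto simp: straight_line_def fun_eq_iff extensional_def)
  ultimately show ?thesis
    unfolding geometrically_isotopic_def path_component_def
    using assms(3)
    by (intro exI[of _ "straight_line n u w"])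
      (auto simp: path_def path_image_def pathstart_def pathfinish_def)
qed

section \<open>Cells and their representatives\<close>

lemma inv_permutation_in:
  assumes "cell_index n \<sigma>" "i \<in> {1..<n}"
  shows "inv (\<sigma> c) i \<in> {1..<n}"
proof -
  have "\<sigma> c permutes {1..<n}" using assms(1) by (simp add: cell_index_def)
  from permutes_in_image[OF permutes_inv[OF this]] assms(2) show ?thesis by simp
qed

lemma representative_nth:
  assumes "i \<in> {1..<n}"
  shows "representative n \<sigma> i $ c = real (inv (\<sigma> c) i) / real n"
  using assms by (simp add: representative_def)

lemma representative_curve:
  assumes "cell_index n \<sigma>"
  shows "representative n \<sigma> \<in> plumbers_curves n"
proof -
  have "0 < inv (\<sigma> c) i" "inv (\<sigma> c) i < n" if "1 \<le> i" "i < n" for c i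
    using inv_permutation_in[OF assms, of i c] that by auto
  then show ?thesis
    by (auto simp: representative_def plumbers_curves_def PiE_iff)
qed

lemma representative_less_iff:
  assumes "i \<in> {1..<n}" "j \<in> {1..<n}"
  shows "representative n \<sigma> i $ c < representative n \<sigma> j $ c \<longleftrightarrow> inv (\<sigma> c) i < inv (\<sigma> c) j"
  using assms by (simp add: representative_nth divide_less_cancel)

lemma representative_refines_iff:
  "refines n (representative n \<sigma>) v \<longleftrightarrow>
    (\<forall>c. \<forall>i\<in>{1..<n}. \<forall>j\<in>{1..<n}. v i $ c < v j $ c \<longrightarrow> inv (\<sigma> c) i < inv (\<sigma> c) j)"
  unfolding refines_def using representative_less_iff by blast

lemma cell_less_iff:
  assumes "cell_index n \<sigma>" "w \<in> cell n \<sigma>" "i \<in> {1..<n}" "j \<in> {1..<n}"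
  shows "w i $ c < w j $ c \<longleftrightarrow> inv (\<sigma> c) i < inv (\<sigma> c) j"
proof -
  have "strict_mono_on {1..<n} (\<lambda>i. w (\<sigma> c i) $ c)"
    using assms(2) by (simp add: cell_def)
  moreover have "\<sigma> c (inv (\<sigma> c) k) = k" for k
    using assms(1) by (auto simp: cell_index_def intro: permutes_inverses(1))
  ultimately show ?thesis
    using strict_mono_on_less[of "{1..<n}" "\<lambda>i. w (\<sigma> c i) $ c" "inv (\<sigma> c) i" "inv (\<sigma> c) j"]
      inv_permutation_in[OF assms(1,3), of c] inv_permutation_in[OF assms(1,4), of c]
    by simp
qed

lemma representative_refines_cell:
  assumes "cell_index n \<sigma>" "w \<in> cell n \<sigma>"
  shows "refines n (representative n \<sigma>) w"
  using cell_less_iff[OF assms] by (simp add: representative_refines_iff)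

lemma cell_subset_knots:
  assumes "cell_index n \<sigma>"
  shows "cell n \<sigma> \<subseteq> plumbers_knots n"
proof
  fix w assume w: "w \<in> cell n \<sigma>"
  have "inj_on (\<lambda>i. w i $ c) {1..<n}" for c
  proof (rule inj_onI)
    fix i j assume "i \<in> {1..<n}" "j \<in> {1..<n}" "w i $ c = w j $ c"
    then have "inv (\<sigma> c) i = inv (\<sigma> c) j"
      using cell_less_iff[OF assms w, of i j c] cell_less_iff[OF assms w, of j i c] by simp
    then show "i = j" using assms by (metis cell_index_def permutes_inverses(1))
  qed
  with w show "w \<in> plumbers_knots n"
    by (intro injective_coordinates_knot) (auto simp: cell_def)
qed

lemma isotopic_to_representative:
  assumes "cell_index n \<sigma>" "w \<in> cell n \<sigma>"
  shows "geometrically_isotopic n w (representative n \<sigma>)"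
proof (rule straight_line_isotopy)
  have w: "w \<in> plumbers_knots n" "w \<in> plumbers_curves n"
    using cell_subset_knots assms by (auto simp: cell_def)
  note rep = representative_curve[OF assms(1)]
  show "w \<in> extensional {1..<n}" "representative n \<sigma> \<in> extensional {1..<n}"
    using w(2) rep by (auto simp: plumbers_curves_def PiE_def)
  fix t :: real assume t: "t \<in> {0..1}"
  have "refines n w w" by (simp add: refines_def)
  from straight_line_refines[OF this representative_refines_cell[OF assms] t]
  show "straight_line n w (representative n \<sigma>) t \<in> plumbers_knots n"
    using refines_knot straight_line_in_curves[OF w(2) rep t] w(1) by blast
qed

text \<open>
  Rank the indices by their value under \<open>f\<close>, breaking ties by the index itself.
\<close>

lemma exists_order_preserving_permutation:
  fixes f :: "nat \<Rightarrow> real"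
  shows "\<exists>p. p permutes {1..<n} \<and> (\<forall>i\<in>{1..<n}. \<forall>j\<in>{1..<n}. f i < f j \<longrightarrow> p i < p j)"
proof -
  let ?I = "{1..<n}"
  define below where "below i = {j \<in> ?I. f j < f i \<or> f j = f i \<and> j \<le> i}" for i
  define rank where "rank i = (if i \<in> ?I then card (below i) else i)" for i
  have below_sub: "below i \<subseteq> ?I" for i unfolding below_def by blast
  have finite_below: "finite (below i)" for i
    by (rule finite_subset[OF below_sub finite_atLeastLessThan])
  have rank_less: "rank i < rank j"
    if "i \<in> ?I" "j \<in> ?I" "f i < f j \<or> f i = f j \<and> i < j" for i j
  proof -
    have "below i \<subseteq> below j" using that(3) unfolding below_def by fastforce
    moreover have "j \<in> below j" "j \<notin> below i"
      using that unfolding below_def by auto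
    ultimately have "below i \<subset> below j" by blast
    from psubset_card_mono[OF finite_below this] show ?thesis
      using that(1,2) by (simp only: rank_def if_True)
  qed
  have inj: "inj_on rank ?I"
  proof (rule inj_onI, rule ccontr)
    fix i j assume ij: "i \<in> ?I" "j \<in> ?I" "rank i = rank j" "i \<noteq> j"
    then have "f i < f j \<or> f i = f j \<and> i < j \<or> f j < f i \<or> f j = f i \<and> j < i" by linarith
    then have "rank i < rank j \<or> rank j < rank i"
      using rank_less[OF ij(1,2)] rank_less[OF ij(2,1)] by blast
    with ij(3) show False by simp
  qed
  have "rank i \<in> ?I" if "i \<in> ?I" for i
  proof -
    have "card (below i) \<le> n - 1"
      using card_mono[OF finite_atLeastLessThan below_sub] by simp
    moreover have "i \<in> below i" using that by (simp add: below_def)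
    then have "0 < card (below i)" using finite_below by (metis card_gt_0_iff empty_iff)
    ultimately show ?thesis using that by (simp add: rank_def)
  qed
  then have "rank ` ?I \<subseteq> ?I" by blast
  from endo_inj_surj[OF finite_atLeastLessThan this inj] inj
  have "bij_betw rank ?I ?I" by (simp only: bij_betw_def)
  then have "rank permutes ?I"
    by (rule bij_imp_permutes) (simp only: rank_def if_False)
  with rank_less show ?thesis by (intro exI[of _ rank]) blast
qed

lemma exists_refining_representative:
  obtains \<sigma> where "cell_index n \<sigma>" "refines n (representative n \<sigma>) v"
proof -
  have "\<forall>c. \<exists>p. p permutes {1..<n} \<and>
      (\<forall>i\<in>{1..<n}. \<forall>j\<in>{1..<n}. v i $ c < v j $ c \<longrightarrow> p i < p j)"
    by (intro allI exists_order_preserving_permutation)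
  then obtain p where p: "\<forall>c. p c permutes {1..<n} \<and>
      (\<forall>i\<in>{1..<n}. \<forall>j\<in>{1..<n}. v i $ c < v j $ c \<longrightarrow> p c i < p c j)"
    by (rule choice[THEN exE])
  then have perm: "p c permutes {1..<n}" for c by blast
  show ?thesis
  proof (rule that[of "\<lambda>c. inv (p c)"])
    show "cell_index n (\<lambda>c. inv (p c))"
      using perm by (simp add: cell_index_def permutes_inv)
    show "refines n (representative n (\<lambda>c. inv (p c))) v"
      unfolding representative_refines_iff permutes_inv_inv[OF perm] using p by blast
  qed
qed

section \<open>Adjacent swaps inside the refinements of a knot\<close>

text \<open>
  The inverse of \<open>\<tau> \<circ> \<sigma> c\<close> is \<open>inv (\<sigma> c) \<circ> \<tau>\<close>, and \<open>\<tau>\<close> permutes two vertices that \<open>v\<close> does not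
  distinguish in direction \<open>c\<close>. So exchanging them preserves the refinement of \<open>v\<close>, and the
  straight line between the representatives consists of refinements of the knot \<open>v\<close>.
\<close>

lemma elementary_isotopy_swap:
  fixes \<sigma> c i
  defines "\<tau> \<equiv> Transposition.transpose (\<sigma> c i) (\<sigma> c (i + 1))"
  assumes "cell_index n \<sigma>" "v \<in> plumbers_knots n" "refines n (representative n \<sigma>) v"
    and i: "i \<in> {1..n - 2}" and eq: "v (\<sigma> c i) $ c = v (\<sigma> c (i + 1)) $ c"
  shows "cell_index n (\<sigma>(c := \<tau> \<circ> \<sigma> c))"
    and "refines n (representative n (\<sigma>(c := \<tau> \<circ> \<sigma> c))) v"
    and "elementary_isotopy n (representative n \<sigma>) (representative n (\<sigma>(c := \<tau> \<circ> \<sigma> c)))"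
proof -
  have s: "\<sigma> c permutes {1..<n}" using assms(2) by (simp add: cell_index_def)
  have "i \<in> {1..<n}" "i + 1 \<in> {1..<n}" using i by auto
  then have in_I: "\<sigma> c i \<in> {1..<n}" "\<sigma> c (i + 1) \<in> {1..<n}"
    using permutes_in_image[OF s] by blast+
  then have tau: "\<tau> permutes {1..<n}" unfolding \<tau>_def by (rule permutes_swap_id)
  show idx: "cell_index n (\<sigma>(c := \<tau> \<circ> \<sigma> c))"
    using assms(2) permutes_compose[OF s tau] by (simp add: cell_index_def)
  have inv_swap: "inv (\<tau> \<circ> \<sigma> c) = inv (\<sigma> c) \<circ> \<tau>"
    using o_inv_distrib[OF permutes_bij[OF tau] permutes_bij[OF s]] by (simp add: \<tau>_def)
  have v_tau: "v (\<tau> j) $ c = v j $ c" for j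
    using eq by (auto simp: \<tau>_def Transposition.transpose_def)
  have tau_in: "\<tau> j \<in> {1..<n}" if "j \<in> {1..<n}" for j
    using permutes_in_image[OF tau] that by blast
  show ref: "refines n (representative n (\<sigma>(c := \<tau> \<circ> \<sigma> c))) v"
    using assms(4) tau_in v_tau unfolding representative_refines_iff
    by (auto simp: inv_swap)
  have "straight_line n (representative n \<sigma>) (representative n (\<sigma>(c := \<tau> \<circ> \<sigma> c))) t
      \<in> plumbers_knots n" if "t \<in> {0..1}" for t
    using refines_knot[OF straight_line_in_curves[OF representative_curve[OF assms(2)]
          representative_curve[OF idx] that] assms(3) straight_line_refines[OF assms(4) ref that]] .
  then show "elementary_isotopy n (representative n \<sigma>) (representative n (\<sigma>(c := \<tau> \<circ> \<sigma> c)))"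
    unfolding elementary_isotopy_def
    by (intro exI[of _ \<sigma>] exI[of _ c] exI[of _ \<tau>])
      (use assms(2) i in \<open>auto simp: appears_in_def \<tau>_def\<close>)
qed

text \<open>
  Without a descent, \<open>p\<close> would be strictly increasing, hence \<open>i \<le> p i\<close> for all \<open>i\<close>, which forces
  a permutation of a finite initial segment to be the identity.
\<close>

lemma nonidentity_permutation_has_descent:
  fixes p :: "nat \<Rightarrow> nat"
  assumes p: "p permutes {1..<n}" and "p \<noteq> id"
  obtains i where "i \<in> {1..n - 2}" "p (i + 1) < p i"
proof -
  have "\<exists>i\<in>{1..n - 2}. p (i + 1) < p i"
  proof (rule ccontr)
    assume "\<not> ?thesis"
    then have asc: "p i < p (Suc i)" if "1 \<le> i" "Suc i < n" for i
      using that permutes_inj[OF p, THEN injD, of i "Suc i"] by force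
    have "i \<le> p i" if "1 \<le> i" "i < n" for i
      using that
    proof (induction i rule: nat_induct_at_least)
      case base
      have "p 1 \<in> {1..<n}" using permutes_in_image[OF p] base by simp
      then show ?case by simp
    next
      case (Suc i)
      then show ?case using asc[of i] by simp
    qed
    then have "p = id" using permutes_natset_ge[OF p] by auto
    with assms(2) show False by simp
  qed
  with that show ?thesis by blast
qed

text \<open>
  Termination measure for bubble sort. The decreasing weights \<open>n - j\<close> make the sum smaller
  when the larger of two neighbouring values moves to the right.
\<close>

lemma weighted_sum_swap_descent:
  fixes p :: "nat \<Rightarrow> nat"
  assumes i: "i \<in> {1..n - 2}" and desc: "p (i + 1) < p i"
  shows "(\<Sum>j\<in>{1..<n}. (n - j) * (p \<circ> Transposition.transpose i (i + 1)) j)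
    < (\<Sum>j\<in>{1..<n}. (n - j) * p j)"
proof -
  let ?R = "{1..<n} - {i, i + 1}" and ?q = "p \<circ> Transposition.transpose i (i + 1)"
  have split: "(\<Sum>j\<in>{1..<n}. f j) = (\<Sum>j\<in>?R. f j) + (f i + f (i + 1))" for f :: "nat \<Rightarrow> nat"
  proof -
    have "{i, i + 1} \<subseteq> {1..<n}" using i by auto
    from sum.subset_diff[OF this, of f] show ?thesis by simp
  qed
  have rest: "(\<Sum>j\<in>?R. (n - j) * ?q j) = (\<Sum>j\<in>?R. (n - j) * p j)"
    by (rule sum.cong) (auto simp: Transposition.transpose_def)
  obtain m where m: "n - i = Suc m" "n - (i + 1) = m"
    using i by (intro that[of "n - i - 1"]) auto
  show ?thesis
    unfolding split rest m using desc by (simp add: algebra_simps)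
qed

text \<open>
  Bubble sort of \<open>inv (\<sigma>' c) \<circ> \<sigma> c\<close>, which is the identity exactly when \<open>\<sigma> c = \<sigma>' c\<close>. At a
  descent, \<open>\<sigma>\<close> and \<open>\<sigma>'\<close> order two vertices oppositely; as both refine \<open>v\<close>, their
  \<open>c\<close>-coordinates in \<open>v\<close> coincide and \<open>elementary_isotopy_swap\<close> applies.
\<close>

lemma refining_representatives_connected_in_direction:
  assumes "v \<in> plumbers_knots n"
    and "cell_index n \<sigma>'" "refines n (representative n \<sigma>') v"
    and "cell_index n \<sigma>" "refines n (representative n \<sigma>) v"
  shows "(elementary_isotopy n)\<^sup>*\<^sup>* (representative n \<sigma>) (representative n (\<sigma>(c := \<sigma>' c)))"
  using assms(4,5)
proof (induction "\<Sum>j\<in>{1..<n}. (n - j) * (inv (\<sigma>' c) \<circ> \<sigma> c) j" arbitrary: \<sigma> rule: less_induct)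
  case less
  define p where "p = inv (\<sigma>' c) \<circ> \<sigma> c"
  have s: "\<sigma> c permutes {1..<n}" and s': "\<sigma>' c permutes {1..<n}"
    using less.prems assms(2) by (auto simp: cell_index_def)
  have p: "p permutes {1..<n}"
    unfolding p_def by (rule permutes_compose[OF s permutes_inv[OF s']])
  show ?case
  proof (cases "p = id")
    case True
    have "\<sigma> c = \<sigma>' c \<circ> p" by (simp add: p_def fun_eq_iff permutes_inverses[OF s'])
    with True have "\<sigma>(c := \<sigma>' c) = \<sigma>" by auto
    then show ?thesis by simp
  next
    case False
    then obtain i where i: "i \<in> {1..n - 2}" and desc: "p (i + 1) < p i"
      using nonidentity_permutation_has_descent[OF p] by blast
    let ?a = "\<sigma> c i" and ?b = "\<sigma> c (i + 1)"
    have "i \<in> {1..<n}" "i + 1 \<in> {1..<n}" using i by auto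
    then have in_I: "?a \<in> {1..<n}" "?b \<in> {1..<n}"
      using permutes_in_image[OF s] by blast+
    have "inv (\<sigma> c) ?a < inv (\<sigma> c) ?b" "inv (\<sigma>' c) ?b < inv (\<sigma>' c) ?a"
      using desc by (auto simp: p_def permutes_inverses[OF s])
    then have "\<not> v ?b $ c < v ?a $ c" "\<not> v ?a $ c < v ?b $ c"
      using less.prems(2) assms(3) in_I unfolding representative_refines_iff by (meson less_asym)+
    then have eq: "v ?a $ c = v ?b $ c" by linarith
    define \<rho> where "\<rho> = \<sigma>(c := Transposition.transpose ?a ?b \<circ> \<sigma> c)"
    note swap = elementary_isotopy_swap[OF less.prems(1) assms(1) less.prems(2) i eq, folded \<rho>_def]
    have "\<rho> c = \<sigma> c \<circ> Transposition.transpose i (i + 1)"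
      using permutes_inj[OF s] by (auto simp: \<rho>_def fun_eq_iff Transposition.transpose_def inj_eq)
    then have "inv (\<sigma>' c) \<circ> \<rho> c = p \<circ> Transposition.transpose i (i + 1)"
      by (simp add: p_def o_assoc)
    then have "(elementary_isotopy n)\<^sup>*\<^sup>* (representative n \<rho>) (representative n (\<rho>(c := \<sigma>' c)))"
      using weighted_sum_swap_descent[of i n p, OF i desc] swap(1,2)
      by (intro less.hyps) (auto simp: p_def)
    moreover have "\<rho>(c := \<sigma>' c) = \<sigma>(c := \<sigma>' c)" by (simp add: \<rho>_def)
    ultimately show ?thesis using swap(3) by (simp add: converse_rtranclp_into_rtranclp)
  qed
qed

lemma refining_representatives_connected:
  assumes "v \<in> plumbers_knots n"
    and \<sigma>: "cell_index n \<sigma>" "refines n (representative n \<sigma>) v"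
    and \<sigma>': "cell_index n \<sigma>'" "refines n (representative n \<sigma>') v"
  shows "(elementary_isotopy n)\<^sup>*\<^sup>* (representative n \<sigma>) (representative n \<sigma>')"
proof -
  let ?E = "(elementary_isotopy n)\<^sup>*\<^sup>*"
  have update: "cell_index n (\<rho>(c := \<sigma>' c)) \<and> refines n (representative n (\<rho>(c := \<sigma>' c))) v \<and>
      ?E (representative n \<rho>) (representative n (\<rho>(c := \<sigma>' c)))"
    if "cell_index n \<rho> \<and> refines n (representative n \<rho>) v" for \<rho> c
    using that \<sigma>' refining_representatives_connected_in_direction[OF assms(1) \<sigma>', of \<rho> c]
    by (auto simp: cell_index_def representative_refines_iff)
  define \<rho>1 where "\<rho>1 = \<sigma>(1 := \<sigma>' 1)"
  define \<rho>2 where "\<rho>2 = \<rho>1(2 := \<sigma>' 2)"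
  have "\<rho>2(3 := \<sigma>' 3) = \<sigma>'"
    by (simp add: \<rho>2_def \<rho>1_def fun_eq_iff forall_3)
  then show ?thesis
    using update[of \<sigma> 1] update[of \<rho>1 2] update[of \<rho>2 3] \<sigma>
    by (metis \<rho>1_def \<rho>2_def rtranclp_trans)
qed

section \<open>Following a geometric isotopy\<close>

text \<open>
  Finitely many strict inequalities between continuous functions persist near \<open>t\<close>.
\<close>

lemma eventually_refines:
  fixes g :: "real \<Rightarrow> nat \<Rightarrow> real ^ 3"
  assumes "continuous_on S g" "t \<in> S"
  shows "\<forall>\<^sub>F s in at t within S. refines n (g s) (g t)"
proof -
  have tends: "((\<lambda>s. g s i $ c) \<longlongrightarrow> g t i $ c) (at t within S)" for i c
    using continuous_on_product_then_coordinatewise[OF assms(1), of i] assms(2)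
    by (auto simp: continuous_on_def intro!: tendsto_vec_nth)
  have ev: "\<forall>\<^sub>F s in at t within S. g t i $ c < g t j $ c \<longrightarrow> g s i $ c < g s j $ c" for i j c
  proof (cases "g t i $ c < g t j $ c")
    case True
    have "((\<lambda>s. g s j $ c - g s i $ c) \<longlongrightarrow> g t j $ c - g t i $ c) (at t within S)"
      by (intro tendsto_intros tends)
    from order_tendstoD(1)[OF this, of 0] True show ?thesis by simp
  qed simp
  show ?thesis
    unfolding refines_def
    by (intro eventually_all_finite eventually_ball_finite ballI finite_atLeastLessThan ev)
qed

lemma isotopic_knots_imp_elementary_isotopies:
  assumes "geometrically_isotopic n w1 w2"
    and \<sigma>1: "cell_index n \<sigma>1" "refines n (representative n \<sigma>1) w1"
    and \<sigma>2: "cell_index n \<sigma>2" "refines n (representative n \<sigma>2) w2"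
  shows "(elementary_isotopy n)\<^sup>*\<^sup>* (representative n \<sigma>1) (representative n \<sigma>2)"
proof -
  let ?E = "(elementary_isotopy n)\<^sup>*\<^sup>*"
  obtain g where g: "path g" "path_image g \<subseteq> plumbers_knots n" "pathstart g = w1" "pathfinish g = w2"
    using assms(1) unfolding geometrically_isotopic_def path_component_def by blast
  have cont: "continuous_on {0..1} g" using g(1) by (simp add: path_def)
  have knot: "g t \<in> plumbers_knots n" if "t \<in> {0..1}" for t
    using g(2) that by (auto simp: path_image_def)
  \<comment> \<open>By \<open>refining_representatives_connected\<close>, all representatives refining \<open>g t\<close> are reached
      as soon as one of them is; this is the property shown to be locally constant.\<close>
  define reached where "reached t \<longleftrightarrow>
    (\<forall>\<sigma>. cell_index n \<sigma> \<and> refines n (representative n \<sigma>) (g t) \<longrightarrow>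
      ?E (representative n \<sigma>1) (representative n \<sigma>))" for t
  have "\<forall>\<^sub>F s in at t within {0..1}. reached t = reached s" if t: "t \<in> {0..1}" for t
    using eventually_refines[OF cont t, of n]
  proof (rule eventually_mono)
    fix s assume ref: "refines n (g s) (g t)"
    show "reached t = reached s"
    proof
      assume "reached t"
      then show "reached s" unfolding reached_def using refines_trans[OF _ ref] by blast
    next
      assume s: "reached s"
      obtain \<rho> where \<rho>: "cell_index n \<rho>" "refines n (representative n \<rho>) (g s)"
        using exists_refining_representative .
      then have "?E (representative n \<sigma>1) (representative n \<rho>)"
        using s unfolding reached_def by blast
      then show "reached t"
        unfolding reached_def
        using refining_representatives_connected[OF knot[OF t] \<rho>(1) refines_trans[OF \<rho>(2) ref]]
        by (meson rtranclp_trans)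
    qed
  qed
  then have "reached 0 = reached 1"
    by (intro connected_local_const[of "{0..1::real}"]) auto
  moreover have "reached 0"
    unfolding reached_def
    using refining_representatives_connected[OF knot[of 0] \<sigma>1(1)] \<sigma>1(2) g(3)
    by (simp add: pathstart_def)
  ultimately show ?thesis
    using \<sigma>2 g(4) unfolding reached_def pathfinish_def by blast
qed

lemma elementary_isotopies_imp_isotopic:
  assumes "(elementary_isotopy n)\<^sup>*\<^sup>* u w" "u \<in> plumbers_knots n"
  shows "geometrically_isotopic n u w"
  using assms
proof (induction rule: rtranclp_induct)
  case base
  then show ?case by (simp add: geometrically_isotopic_def path_component_refl)
next
  case (step y z)
  have "geometrically_isotopic n y z"
    using step.hyps(2) unfolding elementary_isotopy_def
    by (auto simp: representative_def intro!: straight_line_isotopy)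
  with step show ?case
    unfolding geometrically_isotopic_def by (meson path_component_trans)
qed

theorem corollary2p17:
  fixes n :: nat
    and \<sigma>1 \<sigma>2 :: "3 \<Rightarrow> nat \<Rightarrow> nat"
    and w1 w2 :: "nat \<Rightarrow> real ^ 3"
  assumes "n \<ge> 2"
    and "cell_index n \<sigma>1" and "cell_index n \<sigma>2"
    and "w1 \<in> cell n \<sigma>1" and "w2 \<in> cell n \<sigma>2"
  shows "geometrically_isotopic n w1 w2 \<longleftrightarrow>
    (elementary_isotopy n)\<^sup>*\<^sup>* (representative n \<sigma>1) (representative n \<sigma>2)"
proof
  assume "geometrically_isotopic n w1 w2"
  then show "(elementary_isotopy n)\<^sup>*\<^sup>* (representative n \<sigma>1) (representative n \<sigma>2)"
    using isotopic_knots_imp_elementary_isotopies representative_refines_cell assms by blast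
next
  assume E: "(elementary_isotopy n)\<^sup>*\<^sup>* (representative n \<sigma>1) (representative n \<sigma>2)"
  have 1: "geometrically_isotopic n w1 (representative n \<sigma>1)"
    and 2: "geometrically_isotopic n w2 (representative n \<sigma>2)"
    using isotopic_to_representative assms by blast+
  from 1 have "representative n \<sigma>1 \<in> plumbers_knots n"
    unfolding geometrically_isotopic_def by (rule path_component_mem(2))
  from elementary_isotopies_imp_isotopic[OF E this] 1 2 show "geometrically_isotopic n w1 w2"
    unfolding geometrically_isotopic_def by (meson path_component_trans path_component_sym)
qed

end
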